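(* For each $b>(\pi/2)^{1/2}$ there exists a smooth function $\phi\in C^\infty(\mathbb R)$ satisfying $$\frac{d^2\phi}{dy^2}=8\pi(1-e^{\phi}),\qquad \phi(y+b)=\phi(y)\ \text{for all } y\in\mathbb R,$$ and attaining its maximum value at $y=0$, such that, writing $\beta=\pi^{1/2}b$, $$\frac1{2b}\int_0^b\phi(1+e^\phi)\,dy+\frac{\beta^2}{3}-\log(4\beta^2)+1-4\sum_{n=1}^\infty\log\big|1-e^{-2n\beta^2}\big|\ <\ 0.$$ *)

theory Defs
  imports "HOL-Analysis.Analysis"
begin

definition smooth_real :: "(real \<Rightarrow> real) \<Rightarrow> bool" where
  "smooth_real f \<longleftrightarrow> (\<forall>n::nat. \<forall>x::real. ((deriv ^^ n) f) differentiable (at x))"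

end

(*
  A solution of phi'' = 8 pi (1 - e^phi) of energy R^2 = phi'^2 / (16 pi) + e^phi - phi - 1 has
  action act R, and its period is b exactly when R is a critical point of act R / beta - R^2, whose
  critical value is the integral in the statement. The solution sought is the minimizer over R >= 0:
  its value is at most that of any other energy level, and on a suitably chosen level the action is
  bounded above by Young's inequality along an explicit curve, a Liouville bubble on a parabolic
  background. With this curve the terms of order beta^2, log beta and 1 cancel, and what is left is
  at most -1/(2 beta^4) up to exponentially small terms.
*)
theory Submission
  imports Defs "HOL-Real_Asymp.Real_Asymp"
begin

section \<open>The potential well and its uniformizing coordinate\<close>

text \<open>In the usual form, the integrals for action and period have endpoints that move with the
  energy and a square root that degenerates there. Both defects disappear in the signed root
  \<open>u = amp phi\<close> of the potential: an orbit becomes the circle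
  \<open>u = R cos s\<close> with momentum \<open>R sin s\<close>, and the integrals run over a
  fixed interval with continuous integrands. The price is a removable singularity of
  \<open>amp\<close> at 0. The test curve models half an orbit in the time
  \<open>t = 2 pi b y\<close>, so \<open>t = B = beta^2\<close> is half a period. In this time the
  equation reads \<open>psi'' = (2 / B) (1 - exp psi)\<close>, and Young's inequality is an equality
  along a true orbit. The parabola has second derivative close to \<open>2 / B\<close>, and the
  bubble would solve Liouville's equation exactly if \<open>exp C = B\<close>. The \<open>C\<close>
  forced by the endpoints satisfies this only approximately, and the mismatch supplies the strict
  sign.\<close>

definition pot :: "real \<Rightarrow> real" where
  "pot x = exp x - x - 1"

definition amp :: "real \<Rightarrow> real" where
  "amp x = sgn x * sqrt (pot x)"

text \<open>Reciprocal of the derivative of \<open>amp\<close>. The value \<open>sqrt 2\<close> is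
  the limit at 0, where \<open>pot x\<close> behaves like \<open>x\<^sup>2 / 2\<close>.\<close>

definition slope :: "real \<Rightarrow> real" where
  "slope x = (if x = 0 then sqrt 2 else 2 * amp x / (exp x - 1))"

definition lev :: "real \<Rightarrow> real" where
  "lev = inv amp"

definition lev' :: "real \<Rightarrow> real" where
  "lev' u = slope (lev u)"

lemma pot_pos: "x \<noteq> 0 \<Longrightarrow> pot x > 0"
  using exp_ge_add_one_self[of x] ln_eq_minus_one[of "exp x"]
  by (auto simp: pot_def less_eq_real_def)

lemma pot_0 [simp]: "pot 0 = 0"
  by (simp add: pot_def)

lemma pot_nonneg: "pot x \<ge> 0"
  using pot_pos[of x] by (cases "x = 0") auto

lemma amp_0 [simp]: "amp 0 = 0"
  by (simp add: amp_def)

lemma amp_sq: "(amp x)\<^sup>2 = pot x"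
  using pot_nonneg[of x] by (auto simp: amp_def power_mult_distrib sgn_if)

lemma sgn_amp: "sgn (amp x) = sgn x"
  using pot_pos[of x] by (cases "x = 0") (auto simp: amp_def sgn_mult)

lemma slope_pos: "slope x > 0"
proof (cases "x = 0")
  case False
  then consider "x > 0" | "x < 0" by linarith
  then show ?thesis
    using sgn_amp[of x] by cases (auto simp: slope_def sgn_if divide_neg_neg split: if_splits)
qed (simp add: slope_def)

lemma exp_minus_one_amp: "(exp x - 1) * slope x = 2 * amp x"
  by (simp add: slope_def)

lemma DERIV_amp_nonzero:
  assumes "x \<noteq> 0"
  shows "(amp has_real_derivative 1 / slope x) (at x)"
proof -
  have "((\<lambda>y. sgn x * sqrt (pot y)) has_real_derivative sgn x * ((exp x - 1) * (inverse (sqrt (pot x)) / 2))) (at x)"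
    unfolding pot_def using pot_pos[OF assms] 
    by (auto intro!: derivative_eq_intros simp: pot_def)
  then have "((\<lambda>y. sgn x * sqrt (pot y)) has_real_derivative 1 / slope x) (at x)"
    by (rule DERIV_cong) (use assms pot_pos[OF assms] in \<open>auto simp: slope_def amp_def sgn_if field_simps\<close>)
  moreover have "\<forall>\<^sub>F y in nhds x. sgn x * sqrt (pot y) = amp y"
  proof (cases "x > 0")
    case True
    then have "\<forall>\<^sub>F y in nhds x. y \<in> {0<..}" by (intro eventually_nhds_in_open) auto
    then show ?thesis by eventually_elim (use True in \<open>auto simp: amp_def\<close>)
  next
    case False
    with assms have "x < 0" by simp
    then have "\<forall>\<^sub>F y in nhds x. y \<in> {..<0}" by (intro eventually_nhds_in_open) auto
    then show ?thesis by eventually_elim (use \<open>x < 0\<close> in \<open>auto simp: amp_def\<close>)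
  qed
  ultimately show ?thesis
    by (subst (asm) DERIV_cong_ev[OF refl _ refl])
qed

lemma half_powr_half: "(1 / 2 :: real) powr (1 / 2) = 1 / sqrt 2" "2 / sqrt 2 = sqrt (2::real)"
  by (simp_all add: powr_half_sqrt real_sqrt_divide real_div_sqrt)

text \<open>At 0 the generic formula is 0/0; the quadratic behaviour of \<open>pot\<close> gives the
  one-sided limits of the difference quotient, and the sign in \<open>amp\<close> makes them
  agree.\<close>

lemma DERIV_amp: "(amp has_real_derivative 1 / slope x) (at x)"
proof (cases "x = 0")
  case True
  have "((\<lambda>x::real. sqrt (exp x - x - 1) / x) \<longlongrightarrow> 1 / sqrt 2) (at_right 0)"
    by (real_asymp simp: half_powr_half)
  then have R: "((\<lambda>y. (amp y - amp 0) / (y - 0)) \<longlongrightarrow> 1 / sqrt 2) (at_right 0)"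
    by (rule Lim_transform_eventually)
       (auto simp: eventually_at_filter amp_def pot_def)
  have "((\<lambda>x::real. - sqrt (exp x - x - 1) / x) \<longlongrightarrow> 1 / sqrt 2) (at_left 0)"
    by (real_asymp simp: half_powr_half)
  then have L: "((\<lambda>y. (amp y - amp 0) / (y - 0)) \<longlongrightarrow> 1 / sqrt 2) (at_left 0)"
    by (rule Lim_transform_eventually)
       (auto simp: eventually_at_filter amp_def pot_def)
  from L R have "((\<lambda>y. (amp y - amp 0) / (y - 0)) \<longlongrightarrow> 1 / sqrt 2) (at 0)"
    unfolding filterlim_at_split ..
  with True show ?thesis
    by (simp add: has_field_derivative_iff slope_def)
qed (rule DERIV_amp_nonzero)

text \<open>Continuity through 0 makes \<open>lev'\<close> continuous, so that the integrals below
  exist and Leibniz' rule applies.\<close>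

lemma isCont_slope: "isCont slope x"
proof (cases "x = 0")
  case True
  have "(slope \<longlongrightarrow> sqrt 2) (at 0)"
  proof -
    have "((\<lambda>x::real. 2 * sqrt (exp x - x - 1) / (exp x - 1)) \<longlongrightarrow> sqrt 2) (at_right 0)"
      by (real_asymp simp: half_powr_half real_div_sqrt)
    then have R: "(slope \<longlongrightarrow> sqrt 2) (at_right 0)"
      by (rule Lim_transform_eventually)
         (auto simp: eventually_at_filter amp_def pot_def slope_def)
    have "((\<lambda>x::real. - 2 * sqrt (exp x - x - 1) / (exp x - 1)) \<longlongrightarrow> sqrt 2) (at_left 0)"
      by (real_asymp simp: half_powr_half real_div_sqrt)
    then have L: "(slope \<longlongrightarrow> sqrt 2) (at_left 0)"
      by (rule Lim_transform_eventually)
         (auto simp: eventually_at_filter amp_def pot_def slope_def)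
    from L R show ?thesis unfolding filterlim_at_split ..
  qed
  with True show ?thesis by (simp add: isCont_def slope_def)
next
  case False
  have "isCont (\<lambda>y. 2 * amp y / (exp y - 1)) x"
    using False DERIV_isCont[OF DERIV_amp] by (intro continuous_intros) auto
  moreover have "\<forall>\<^sub>F y in nhds x. 2 * amp y / (exp y - 1) = slope y"
  proof -
    have "\<forall>\<^sub>F y in nhds x. y \<in> -{0}"
      using False by (intro eventually_nhds_in_open) auto
    then show ?thesis by eventually_elim (auto simp: slope_def)
  qed
  ultimately show ?thesis by (subst isCont_cong[symmetric])
qed

lemma strict_mono_amp: "strict_mono amp"
  by (rule strict_monoI) (metis DERIV_amp DERIV_pos_imp_increasing slope_pos zero_less_divide_1_iff)

lemma surj_amp: "surj amp"
proof -
  have cont: "continuous_on X amp" for X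
    by (meson DERIV_amp DERIV_isCont continuous_at_imp_continuous_on)
  have "\<exists>x. amp x = y" for y
  proof (cases "y \<ge> 0")
    case True
    \<comment> \<open>From \<open>z \<ge> 3\<close>,
      \<open>exp z - z - 1 \<ge> z\<^sup>2 / 2 \<ge> z \<ge> y\<^sup>2\<close>. On the negative side
      the linear part of \<open>pot\<close> alone suffices.\<close>
    define z where "z = 3 + y\<^sup>2"
    have z: "z \<ge> 3" by (simp add: z_def)
    have "1 + z + z\<^sup>2 / 2 \<le> exp z" using z by (intro exp_lower_Taylor_quadratic) auto
    moreover have "z\<^sup>2 \<ge> 3 * z" using z by (simp add: power2_eq_square)
    moreover have "y\<^sup>2 \<le> z" by (simp add: z_def)
    ultimately have "y\<^sup>2 \<le> exp z - z - 1" using z by linarith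
    then have "y \<le> amp z" using True z by (simp add: amp_def pot_def real_le_rsqrt)
    then show ?thesis
      using IVT'[of amp 0 y z] True z cont by auto
  next
    case False
    define z where "z = - 1 - y\<^sup>2"
    have z: "z < 0" using zero_le_power2[of y] unfolding z_def by linarith
    have "(- y)\<^sup>2 \<le> exp z - z - 1" by (simp add: z_def)
    then have "- y \<le> sqrt (exp z - z - 1)" by (rule real_le_rsqrt)
    then have "amp z \<le> y" using z by (simp add: amp_def pot_def)
    then show ?thesis
      using IVT'[of amp z y 0] False z cont by auto
  qed
  then show ?thesis by (metis surjI surj_def)
qed

lemma amp_lev [simp]: "amp (lev u) = u"
  unfolding lev_def by (simp add: surj_amp surj_f_inv_f)

lemma lev_amp [simp]: "lev (amp x) = x"
  unfolding lev_def by (simp add: strict_mono_amp strict_mono_imp_inj_on)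

lemma lev_0 [simp]: "lev 0 = 0"
  using lev_amp[of 0] by simp

lemma lev_le_iff [simp]: "lev u \<le> lev v \<longleftrightarrow> u \<le> v"
  using strict_mono_less_eq[OF strict_mono_amp, of "lev u" "lev v"] by simp

lemma exp_lev: "exp (lev u) = u\<^sup>2 + lev u + 1"
  using amp_sq[of "lev u"] by (simp add: pot_def)

lemma DERIV_lev: "(lev has_real_derivative lev' u) (at u)"
proof -
  have "isCont lev (amp (lev u))"
    by (rule isCont_inverse_function[of 1]) (auto intro: DERIV_isCont[OF DERIV_amp])
  moreover have "1 / slope (lev u) \<noteq> 0" using slope_pos[of "lev u"] by simp
  ultimately show ?thesis
    using DERIV_inverse_function[where f = amp and g = lev and x = u and D = "1 / slope (lev u)" and a = "u - 1" and b = "u + 1"] DERIV_amp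
    by (simp add: lev'_def)
qed

lemma continuous_on_lev [continuous_intros]:
  "continuous_on X h \<Longrightarrow> continuous_on X (\<lambda>x. lev (h x))"
  by (rule continuous_on_compose2[of UNIV lev])
     (auto intro: continuous_at_imp_continuous_on DERIV_isCont[OF DERIV_lev])

lemma continuous_on_lev' [continuous_intros]:
  "continuous_on X h \<Longrightarrow> continuous_on X (\<lambda>x. lev' (h x))"
  unfolding lev'_def
  by (rule continuous_on_compose2[of UNIV slope])
     (auto intro!: continuous_intros intro: continuous_at_imp_continuous_on isCont_slope)

lemma DERIV_lev_comp [derivative_intros]:
  "(h has_real_derivative h') (at x within X) \<Longrightarrow>
   ((\<lambda>x. lev (h x)) has_real_derivative lev' (h x) * h') (at x within X)"
  by (rule DERIV_chain2[OF DERIV_lev])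

lemma lev'_pos: "lev' u > 0"
  by (simp add: lev'_def slope_pos)

text \<open>Derivative of \<open>pot (lev u) = u\<^sup>2\<close> with the exponential eliminated. It
  yields both the differential equation and the evaluation of the integral of the solution.\<close>

lemma lev'_times: "(u\<^sup>2 + lev u) * lev' u = 2 * u"
  using exp_minus_one_amp[of "lev u"] by (simp add: exp_lev lev'_def)

text \<open>On the left branch the exponential is at most 1, so the well grows only linearly there;
  this is the source of the cubic growth of the action.\<close>

lemma lev_neg_le: 
  assumes "u \<le> 0"
  shows "lev u \<le> - u\<^sup>2"
proof -
  have "lev u \<le> lev 0" using assms by (simp del: lev_0)
  then have "exp (lev u) \<le> 1" by simp
  then show ?thesis by (simp add: exp_lev)
qed

lemma lev_mult_nonneg: "lev u * u \<ge> 0"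
  using lev_le_iff[of u 0] lev_le_iff[of 0 u]
  by (metis lev_0 linear mult_nonneg_nonneg mult_nonpos_nonpos)

section \<open>The action and the period of an orbit\<close>

text \<open>With \<open>p = R sin s\<close> this is the integral of \<open>phi dp\<close> over the
  upper half of the orbit, half the enclosed area. Unlike \<open>p dphi\<close> it contains no
  derivative of \<open>lev\<close>, so differentiating in \<open>R\<close> needs only
  \<open>lev'\<close>.\<close>

definition act :: "real \<Rightarrow> real" where
  "act R = integral {0..pi} (\<lambda>s. lev (R * cos s) * (R * cos s))"

text \<open>Half the period times \<open>4 * sqrt pi\<close>.\<close>

definition per :: "real \<Rightarrow> real" where
  "per R = integral {0..pi} (\<lambda>s. lev' (R * cos s))"

text \<open>The classical link between action and period. Leibniz' rule gives \<open>F R\<close>,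
  which differs from \<open>R * lev' (R * cos s)\<close> by the derivative of
  \<open>lev (R * cos s) * sin s\<close>; the boundary values of the latter vanish.\<close>

lemma DERIV_act: "(act has_real_derivative R * per R) (at R)"
proof -
  define F where "F x s = lev' (x * cos s) * cos s * (x * cos s) + lev (x * cos s) * cos s" for x s :: real
  have "((\<lambda>x. integral (cbox 0 pi) (\<lambda>s. lev (x * cos s) * (x * cos s)))
          has_real_derivative integral (cbox 0 pi) (F R)) (at R within UNIV)"
  proof (rule leibniz_rule_field_derivative)
    show "((\<lambda>x. lev (x * cos t) * (x * cos t)) has_real_derivative F x t) (at x within UNIV)" for x t
      unfolding F_def by (auto intro!: derivative_eq_intros simp: algebra_simps)
    show "(\<lambda>s. lev (x * cos s) * (x * cos s)) integrable_on cbox 0 pi" for x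
      by (intro integrable_continuous continuous_intros)
    show "continuous_on (UNIV \<times> cbox 0 pi) (\<lambda>(x, t). F x t)"
      unfolding F_def split_beta by (intro continuous_intros)
  qed auto
  moreover have "(F R has_integral R * per R) {0..pi}"
  proof -
    have "((\<lambda>s. lev' (R * cos s) * (- R * sin s) * sin s + lev (R * cos s) * cos s) has_integral
            lev (R * cos pi) * sin pi - lev (R * cos 0) * sin 0) {0..pi}"
      by (rule fundamental_theorem_of_calculus)
         (auto intro!: derivative_eq_intros simp flip: has_real_derivative_iff_has_vector_derivative)
    moreover have "((\<lambda>s. lev' (R * cos s)) has_integral per R) {0..pi}"
      unfolding per_def by (intro integrable_integral integrable_continuous_interval continuous_intros)
    ultimately have "((\<lambda>s. (lev' (R * cos s) * (- R * sin s) * sin s + lev (R * cos s) * cos s)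
        + R * lev' (R * cos s)) has_integral (lev (R * cos pi) * sin pi - lev (R * cos 0) * sin 0) + R * per R) {0..pi}"
      by (intro has_integral_add has_integral_mult_right)
    moreover have "(lev' (R * cos s) * (- R * sin s) * sin s + lev (R * cos s) * cos s)
        + R * lev' (R * cos s) = F R s" for s
    proof -
      have "lev' (R * cos s) * (- R * sin s) * sin s = - R * lev' (R * cos s) * (sin s)\<^sup>2"
        by (simp add: power2_eq_square)
      then show ?thesis
        unfolding F_def sin_squared_eq by (simp add: power2_eq_square algebra_simps)
    qed
    ultimately show ?thesis by simp
  qed
  ultimately show ?thesis
    by (simp add: act_def[abs_def] integral_unique)
qed

text \<open>The form \<open>p dphi\<close> of the action: integrate by parts with
  \<open>lev (R * cos s) * (R * sin s)\<close>, which is zero at both ends.\<close>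

lemma act_by_parts:
  "((\<lambda>s. lev' (R * cos s) * (R * sin s)\<^sup>2) has_integral act R) {0..pi}"
proof -
  have "((\<lambda>s. lev' (R * cos s) * (- R * sin s) * (R * sin s) + lev (R * cos s) * (R * cos s)) has_integral
          lev (R * cos pi) * (R * sin pi) - lev (R * cos 0) * (R * sin 0)) {0..pi}"
    by (rule fundamental_theorem_of_calculus)
       (auto intro!: derivative_eq_intros simp flip: has_real_derivative_iff_has_vector_derivative)
  moreover have "((\<lambda>s. lev (R * cos s) * (R * cos s)) has_integral act R) {0..pi}"
    unfolding act_def by (intro integrable_integral integrable_continuous_interval continuous_intros)
  ultimately have "((\<lambda>s. lev (R * cos s) * (R * cos s) 
      - (lev' (R * cos s) * (- R * sin s) * (R * sin s) + lev (R * cos s) * (R * cos s))) has_integral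
      act R - (lev (R * cos pi) * (R * sin pi) - lev (R * cos 0) * (R * sin 0))) {0..pi}"
    by (intro has_integral_diff)
  then show ?thesis by (simp add: power2_eq_square mult_ac)
qed

text \<open>Coercivity: cubic growth beats the term \<open>R\<^sup>2\<close> of the functional. The
  integrand is nonnegative; on the last third of the interval \<open>cos s \<le> - 1 / 2\<close>,
  and the length \<open>pi / 3\<close> exceeds 1.\<close>

lemma act_ge:
  assumes "R \<ge> 0"
  shows "act R \<ge> R ^ 3 / 8"
proof -
  have int: "(\<lambda>s. lev (R * cos s) * (R * cos s)) integrable_on {a..b}" for a b
    by (intro integrable_continuous_interval continuous_intros)
  have "R ^ 3 / 8 \<le> R ^ 3 / 8 * (pi / 3)"
    using mult_left_mono[of 1 "pi / 3" "R ^ 3 / 8"] pi_gt3 assms by simp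
  also have "R ^ 3 / 8 * (pi / 3) = integral {2 * pi / 3..pi} (\<lambda>s. R ^ 3 / 8)"
    by simp
  also have "\<dots> \<le> integral {2 * pi / 3..pi} (\<lambda>s. lev (R * cos s) * (R * cos s))"
  proof (rule integral_le[OF _ int])
    fix s assume s: "s \<in> {2 * pi / 3..pi}"
    then have "cos s \<le> cos (2 * pi / 3)" by (intro cos_monotone_0_pi_le) auto
    then have "cos s \<le> - (1 / 2)" by (simp add: cos_120)
    then have u: "R * cos s \<le> - (R / 2)" using mult_left_mono[OF _ assms] by fastforce
    define v where "v = - (R * cos s)"
    have v: "v \<ge> R / 2" using u by (simp add: v_def)
    have "R ^ 3 / 8 = (R / 2) ^ 3" by (simp add: power_divide)
    also have "\<dots> \<le> v ^ 3" using v assms by (intro power_mono) auto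
    also have "\<dots> = v\<^sup>2 * v" by (simp add: power3_eq_cube power2_eq_square)
    also have "\<dots> \<le> (- lev (- v)) * v"
      using lev_neg_le[of "- v"] v assms by (intro mult_right_mono) auto
    finally show "R ^ 3 / 8 \<le> lev (R * cos s) * (R * cos s)" by (simp add: v_def)
  qed auto
  also have "\<dots> \<le> act R"
    unfolding act_def by (rule integral_subset_le) (auto intro: int lev_mult_nonneg)
  finally show ?thesis .
qed

lemma act_0 [simp]: "act 0 = 0"
  by (simp add: act_def)

lemma act_minimizer:
  assumes "\<beta> > 0"
  obtains R where "R \<ge> 0" "\<And>r. r \<ge> 0 \<Longrightarrow> act R / \<beta> - R\<^sup>2 \<le> act r / \<beta> - r\<^sup>2"
    "R = 0 \<or> per R = 2 * \<beta>"
proof -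
  define J where "J r = act r / \<beta> - r\<^sup>2" for r
  have J: "(J has_real_derivative r * per r / \<beta> - 2 * r) (at r)" for r
    unfolding J_def using assms by (auto intro!: derivative_eq_intros DERIV_act)
  \<comment> \<open>Beyond \<open>8 * \<beta>\<close> the cubic bound gives
    \<open>J r \<ge> 0 = J 0\<close>, so the minimum over this interval is global.\<close>
  have "continuous_on {0..8 * \<beta>} J"
    by (meson J DERIV_isCont continuous_at_imp_continuous_on)
  then obtain R where R: "R \<in> {0..8 * \<beta>}" "\<And>r. r \<in> {0..8 * \<beta>} \<Longrightarrow> J R \<le> J r"
    using continuous_attains_inf[of "{0..8 * \<beta>}" J] assms by auto
  have min: "J R \<le> J r" if "r \<ge> 0" for r
  proof (cases "r \<le> 8 * \<beta>")
    case False
    have "J R \<le> J 0" using R(2)[of 0] assms by simp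
    also have "J 0 = 0" by (simp add: J_def)
    also have "0 \<le> J r"
    proof -
      have "r\<^sup>2 * (8 * \<beta>) \<le> r\<^sup>2 * r" using False by (intro mult_left_mono) auto
      also have "r\<^sup>2 * r = r ^ 3" by (simp add: power3_eq_cube power2_eq_square)
      finally have "r\<^sup>2 * \<beta> \<le> act r" using act_ge[OF that] by simp
      then have "r\<^sup>2 \<le> act r / \<beta>" using assms by (simp only: pos_le_divide_eq)
      then show ?thesis by (simp add: J_def)
    qed
    finally show ?thesis .
  qed (use R that in auto)
  moreover have "per R = 2 * \<beta>" if "R \<noteq> 0"
  proof -
    have "R > 0" using that R(1) by auto
    \<comment> \<open>The neighbourhood \<open>(0, 2 R)\<close> lies in the half line on which
      \<open>R\<close> is minimal, so the critical equation also holds if \<open>R\<close> is the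
      right end of the compact interval.\<close>
    then have "R * per R / \<beta> - 2 * R = 0"
      by (intro DERIV_local_min[OF J, of R R]) (auto intro!: min)
    then show ?thesis using \<open>R > 0\<close> assms by (simp add: field_simps)
  qed
  ultimately show ?thesis using R(1) that[of R] unfolding J_def by auto
qed

lemma continuous_real_antiderivative:
  fixes f :: "real \<Rightarrow> real"
  assumes "continuous_on UNIV f"
  obtains F where "\<And>x. (F has_real_derivative f x) (at x)"
proof -
  have "\<exists>F. \<forall>x::real. - \<infinity> < ereal x \<longrightarrow> ereal x < \<infinity> \<longrightarrow> (F has_vector_derivative f x) (at x)"
    using assms by (intro einterval_antiderivative) (auto simp: continuous_on_eq_continuous_at)
  then show ?thesis using that by (auto simp: has_real_derivative_iff_has_vector_derivative)
qed

lemma integral_cos_reflect: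
  fixes h :: "real \<Rightarrow> real"
  assumes h: "continuous_on UNIV h"
  shows "integral {0..2 * pi} (\<lambda>s. h (cos s)) = 2 * integral {0..pi} (\<lambda>s. h (cos s))"
proof -
  have cont: "continuous_on X (\<lambda>s. h (cos s))" for X
    by (rule continuous_on_compose2[OF h]) (auto intro: continuous_intros)
  have "((\<lambda>s. h (cos s)) has_integral integral {0..pi} (\<lambda>s. h (cos s))) (cbox 0 pi)"
    using integrable_integral[OF integrable_continuous_interval[OF cont]] by simp
  from has_integral_affinity[OF this, of "-1" "2 * pi"]
  have "((\<lambda>s. h (cos (2 * pi - s))) has_integral integral {0..pi} (\<lambda>s. h (cos s)))
      ((\<lambda>x. 2 * pi - x) ` {0..pi})"
    by simp
  moreover have "(\<lambda>x. 2 * pi - x) ` {0..pi} = {pi..2 * pi}" by (simp add: image_diff_atLeastAtMost)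
  moreover have "cos (2 * pi - s) = cos s" for s by (simp add: cos_diff)
  ultimately have "integral {pi..2 * pi} (\<lambda>s. h (cos s)) = integral {0..pi} (\<lambda>s. h (cos s))"
    by (simp add: integral_unique)
  moreover have "integral {0..pi} (\<lambda>s. h (cos s)) + integral {pi..2 * pi} (\<lambda>s. h (cos s))
      = integral {0..2 * pi} (\<lambda>s. h (cos s))"
    by (rule Henstock_Kurzweil_Integration.integral_combine) (auto intro: integrable_continuous_interval cont)
  ultimately show ?thesis by simp
qed

section \<open>Periodic solutions\<close>

text \<open>Polynomials in \<open>p\<close>, \<open>q\<close> and \<open>exp p\<close>. Under the
  differential equation this class is closed under differentiation, so it contains every iterated
  derivative of \<open>p\<close>.\<close>

inductive ode_alg :: "(real \<Rightarrow> real) \<Rightarrow> (real \<Rightarrow> real) \<Rightarrow> (real \<Rightarrow> real) \<Rightarrow> bool"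
  for p q :: "real \<Rightarrow> real" where
  const: "ode_alg p q (\<lambda>x. c)"
| fst: "ode_alg p q p"
| snd: "ode_alg p q q"
| exp: "ode_alg p q (\<lambda>x. exp (p x))"
| add: "ode_alg p q f \<Longrightarrow> ode_alg p q g \<Longrightarrow> ode_alg p q (\<lambda>x. f x + g x)"
| mult: "ode_alg p q f \<Longrightarrow> ode_alg p q g \<Longrightarrow> ode_alg p q (\<lambda>x. f x * g x)"

lemma ode_alg_deriv:
  assumes p: "\<And>x. (p has_real_derivative q x) (at x)"
    and q: "\<And>x. (q has_real_derivative c * (1 - exp (p x))) (at x)"
    and "ode_alg p q f"
  shows "\<exists>f'. ode_alg p q f' \<and> (\<forall>x. (f has_real_derivative f' x) (at x))"
  using assms(3)
proof induction
  case (const c)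
  show ?case by (rule exI[of _ "\<lambda>x. 0"]) (auto intro: ode_alg.const)
next
  case fst
  show ?case using p by (blast intro: ode_alg.snd)
next
  case snd
  have "ode_alg p q (\<lambda>x. c * (1 + (- 1) * exp (p x)))" by (intro ode_alg.intros)
  with q show ?case by (auto intro!: exI[of _ "\<lambda>x. c * (1 + (- 1) * exp (p x))"])
next
  case exp
  have "ode_alg p q (\<lambda>x. exp (p x) * q x)" by (intro ode_alg.intros)
  moreover have "((\<lambda>x. exp (p x)) has_real_derivative exp (p x) * q x) (at x)" for x
    by (auto intro!: derivative_eq_intros p)
  ultimately show ?case by blast
next
  case (add f g)
  then obtain f' g' where "ode_alg p q f'" "ode_alg p q g'"
    "\<And>x. (f has_real_derivative f' x) (at x)" "\<And>x. (g has_real_derivative g' x) (at x)" by blast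
  then show ?case
    by (intro exI[of _ "\<lambda>x. f' x + g' x"]) (auto intro!: ode_alg.intros derivative_intros)
next
  case (mult f g)
  then obtain f' g' where "ode_alg p q f'" "ode_alg p q g'"
    "\<And>x. (f has_real_derivative f' x) (at x)" "\<And>x. (g has_real_derivative g' x) (at x)" by blast
  moreover have "ode_alg p q (\<lambda>x. f' x * g x + g' x * f x)"
    using calculation mult by (intro ode_alg.intros)
  ultimately show ?case
    by (intro exI[of _ "\<lambda>x. f' x * g x + g' x * f x"]) (auto intro!: DERIV_mult)
qed

lemma smooth_real_ode:
  assumes p: "\<And>x. (p has_real_derivative q x) (at x)"
    and q: "\<And>x. (q has_real_derivative c * (1 - exp (p x))) (at x)"
  shows "smooth_real p"
proof -
  have alg: "ode_alg p q ((deriv ^^ n) p)" for n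
  proof (induction n)
    case (Suc n)
    then obtain f' where f': "ode_alg p q f'" "\<And>x. ((deriv ^^ n) p has_real_derivative f' x) (at x)"
      using ode_alg_deriv[OF p q] by blast
    then have "(deriv ^^ Suc n) p = f'" by (auto intro!: ext DERIV_imp_deriv)
    with f' show ?case by simp
  qed (simp add: ode_alg.fst)
  show ?thesis
    unfolding smooth_real_def
    using ode_alg_deriv[OF p q alg] real_differentiable_def by blast
qed

text \<open>On the orbit of energy \<open>R\<^sup>2\<close> write \<open>\<phi> = lev (R cos s)\<close>. Then \<open>dy/ds = lev' (R cos s) / (4 sqrt pi)\<close>,
  which is continuous and positive even at the turning points, so that \<open>\<phi>\<close> is obtained by inverting
  a diffeomorphism of the line.\<close>

lemma orbit_angle:
  assumes b: "b > 0" and per: "per R = 2 * sqrt pi * b"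
  obtains Y s where "\<And>t. (Y has_real_derivative lev' (R * cos t) / (4 * sqrt pi)) (at t)"
    "Y 0 = 0" "Y (2 * pi) = b" "\<And>t. s (Y t) = t" 
    "\<And>y. (s has_real_derivative 4 * sqrt pi / lev' (R * cos (s y))) (at y)"
    "\<And>y. s (y + b) = s y + 2 * pi"
proof -
  define w where "w t = lev' (R * cos t) / (4 * sqrt pi)" for t
  have w: "w t > 0" for t by (simp add: w_def lev'_pos)
  have "continuous_on UNIV w" unfolding w_def by (intro continuous_intros) auto
  then obtain Y0 where Y0: "\<And>t. (Y0 has_real_derivative w t) (at t)"
    using continuous_real_antiderivative by blast
  define Y where "Y t = Y0 t - Y0 0" for t
  have Y: "(Y has_real_derivative w t) (at t)" for t
    unfolding Y_def by (auto intro!: derivative_eq_intros Y0)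
  have Y_0: "Y 0 = 0" by (simp add: Y_def)
  have "(w has_integral Y (2 * pi) - Y 0) {0..2 * pi}"
    by (rule fundamental_theorem_of_calculus)
       (auto intro!: has_field_derivative_at_within Y simp flip: has_real_derivative_iff_has_vector_derivative)
  then have "Y (2 * pi) = integral {0..2 * pi} (\<lambda>t. lev' (R * cos t) / (4 * sqrt pi))"
    by (simp add: integral_unique Y_0 w_def[abs_def] del: integral_divide)
  also have "\<dots> = 2 * per R / (4 * sqrt pi)"
  proof -
    have "continuous_on UNIV (\<lambda>c. lev' (R * c) / (4 * sqrt pi))" by (intro continuous_intros) auto
    from integral_cos_reflect[OF this] show ?thesis by (simp add: per_def)
  qed
  also have "\<dots> = b" using b per by (simp add: field_simps)
  finally have Y_2pi: "Y (2 * pi) = b" .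
  have shift: "Y (t + 2 * pi) = Y t + b" for t
  proof -
    have "w (u + 2 * pi) = w u" for u by (simp add: w_def)
    then have "((\<lambda>t. Y (t + 2 * pi)) has_real_derivative w u) (at u)" for u
      using Y[of "u + 2 * pi"] by (simp only: DERIV_shift)
    from DERIV_diff[OF this Y]
    have "((\<lambda>t. Y (t + 2 * pi) - Y t) has_real_derivative 0) (at u)" for u by simp
    then have "Y (t + 2 * pi) - Y t = Y (0 + 2 * pi) - Y 0"
      by (rule DERIV_isconst_all[rule_format]) 
    then show ?thesis by (simp add: Y_0 Y_2pi)
  qed
  have mono: "strict_mono Y"
  proof (rule strict_monoI)
    fix x y :: real assume "x < y"
    then show "Y x < Y y" by (rule DERIV_pos_imp_increasing) (intro exI conjI, rule Y, rule w)
  qed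
  have cont: "continuous_on X Y" for X
    by (meson Y DERIV_isCont continuous_at_imp_continuous_on)
  \<comment> \<open>Shifting in both directions shows that \<open>Y\<close> is unbounded above and
    below, hence onto by the intermediate value theorem.\<close>
  have multiples: "Y (2 * pi * real n) = real n * b \<and> Y (- (2 * pi * real n)) = - (real n * b)" for n
  proof (induction n)
    case (Suc n)
    have shift': "Y u = Y t + b" if "u = t + 2 * pi" for t u using shift that by simp
    have "Y (2 * pi * real (Suc n)) = Y (2 * pi * real n) + b"
      by (rule shift') (simp add: algebra_simps)
    moreover have "Y (- (2 * pi * real n)) = Y (- (2 * pi * real (Suc n))) + b"
      by (rule shift') (simp add: algebra_simps)
    moreover have "real (Suc n) * b = real n * b + b" by (simp add: distrib_right)
    ultimately show ?case using Suc by linarith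
  qed (simp add: Y_0)
  have "\<exists>t. Y t = y" for y
  proof -
    obtain n where "\<bar>y\<bar> < real n * b" using reals_Archimedean3[OF b] by blast
    then have "- (real n * b) \<le> y" "y \<le> real n * b" by linarith+
    then show ?thesis
      using IVT'[of Y "- (2 * pi * real n)" y "2 * pi * real n"] multiples[of n] cont by auto
  qed
  then have surj: "surj Y" by (metis surj_def)
  define s where "s = inv Y"
  have Ys: "Y (s y) = y" for y by (simp add: s_def surj surj_f_inv_f)
  have sY: "s (Y t) = t" for t by (simp add: s_def mono strict_mono_imp_inj_on)
  have "(s has_real_derivative inverse (w (s y))) (at y)" for y
  proof (rule DERIV_inverse_function[where a = "y - 1" and b = "y + 1"])
    show "w (s y) \<noteq> 0" using w[of "s y"] by simp
    have "isCont s (Y (s y))"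
      by (rule isCont_inverse_function[of 1]) (auto simp: sY intro: DERIV_isCont[OF Y])
    then show "isCont s y" by (simp add: Ys)
    show "(Y has_real_derivative w (s y)) (at (s y))" by (rule Y)
  qed (simp_all add: Ys)
  then have "(s has_real_derivative 4 * sqrt pi / lev' (R * cos (s y))) (at y)" for y
    unfolding w_def inverse_divide .
  moreover have "s (y + b) = s y + 2 * pi" for y
    using sY[of "s y + 2 * pi"] by (simp add: shift Ys)
  ultimately show ?thesis
    by (intro that[OF Y[unfolded w_def] Y_0 Y_2pi sY])
qed

text \<open>The period condition acts twice: it closes the orbit after \<open>b\<close>, and it
  turns the term \<open>R\<^sup>2 * per R\<close> of the integral into the
  \<open>- R\<^sup>2\<close> of the value.\<close>

lemma orbit_solution:
  assumes R: "R > 0" and b: "b > 0" and per: "per R = 2 * sqrt pi * b"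
  obtains \<phi> where "smooth_real \<phi>"
    "\<And>y. deriv (deriv \<phi>) y = 8 * pi * (1 - exp (\<phi> y))"
    "\<And>y. \<phi> (y + b) = \<phi> y" "\<And>y. \<phi> y \<le> \<phi> 0"
    "1 / (2 * b) * integral {0..b} (\<lambda>y. \<phi> y * (1 + exp (\<phi> y))) = act R / (sqrt pi * b) - R\<^sup>2"
proof -
  from orbit_angle[OF b per] obtain Y s
    where Y: "\<And>t. (Y has_real_derivative lev' (R * cos t) / (4 * sqrt pi)) (at t)"
    and Y0: "Y 0 = 0" and Y2: "Y (2 * pi) = b" and sY: "\<And>t. s (Y t) = t"
    and s: "\<And>y. (s has_real_derivative 4 * sqrt pi / lev' (R * cos (s y))) (at y)"
    and shift: "\<And>y. s (y + b) = s y + 2 * pi" by blast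
  define \<phi> where "\<phi> y = lev (R * cos (s y))" for y
  define \<psi> where "\<psi> y = - 4 * sqrt pi * R * sin (s y)" for y
  have \<phi>: "(\<phi> has_real_derivative \<psi> y) (at y)" for y
  proof -
    have "(\<phi> has_real_derivative lev' (R * cos (s y)) * (R * (- sin (s y) * (4 * sqrt pi / lev' (R * cos (s y)))))) (at y)"
      unfolding \<phi>_def by (auto intro!: derivative_eq_intros s)
    then show ?thesis
      using lev'_pos[of "R * cos (s y)"] by (simp add: \<psi>_def mult_ac)
  qed
  have \<psi>: "(\<psi> has_real_derivative 8 * pi * (1 - exp (\<phi> y))) (at y)" for y
  proof -
    define u where "u = R * cos (s y)"
    have "(\<psi> has_real_derivative - 4 * sqrt pi * R * (cos (s y) * (4 * sqrt pi / lev' u))) (at y)"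
      unfolding \<psi>_def u_def by (auto intro!: derivative_eq_intros s)
    also have "- 4 * sqrt pi * R * (cos (s y) * (4 * sqrt pi / lev' u)) = - 8 * pi * (2 * u / lev' u)"
      by (simp add: u_def)
    also have "2 * u / lev' u = exp (\<phi> y) - 1"
      using lev'_times[of u] lev'_pos[of u] by (simp add: \<phi>_def exp_lev flip: u_def) (simp add: field_simps)
    finally show ?thesis by (simp add: algebra_simps)
  qed
  have d1: "deriv \<phi> = \<psi>" using \<phi> by (auto intro!: ext DERIV_imp_deriv)
  have d2: "deriv \<psi> y = 8 * pi * (1 - exp (\<phi> y))" for y using \<psi> by (auto intro!: DERIV_imp_deriv)
  have s0: "s 0 = 0" using sY[of 0] Y0 by simp
  have "integral {0..b} (\<lambda>y. \<phi> y * (1 + exp (\<phi> y))) = (2 * act R - R\<^sup>2 * per R) / sqrt pi"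
  proof -
    have cont_\<phi>: "continuous_on X \<phi>" for X
      by (meson \<phi> DERIV_isCont continuous_at_imp_continuous_on)
    have mono: "Y x \<le> Y y" if "x \<le> y" for x y
    proof (rule DERIV_nonneg_imp_nondecreasing[OF that])
      show "\<exists>d. (Y has_real_derivative d) (at t) \<and> d \<ge> 0" for t
        using Y[of t] lev'_pos[of "R * cos t"] by (intro exI conjI) auto
    qed
    have "((\<lambda>t. (lev' (R * cos t) / (4 * sqrt pi)) *\<^sub>R (\<phi> (Y t) * (1 + exp (\<phi> (Y t)))))
        has_integral integral {Y 0..Y (2 * pi)} (\<lambda>y. \<phi> y * (1 + exp (\<phi> y)))) {0..2 * pi}"
    proof (rule has_integral_substitution[where f = "\<lambda>y. \<phi> y * (1 + exp (\<phi> y))" and g = Y and c = "Y 0" and d = "Y (2 * pi)"])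
      show "Y ` {0..2 * pi} \<subseteq> {Y 0..Y (2 * pi)}" using mono by auto
    qed (auto intro!: has_field_derivative_at_within Y continuous_intros cont_\<phi> mono)
    then have "integral {0..b} (\<lambda>y. \<phi> y * (1 + exp (\<phi> y)))
        = integral {0..2 * pi} (\<lambda>t. lev' (R * cos t) / (4 * sqrt pi) * (\<phi> (Y t) * (1 + exp (\<phi> (Y t)))))"
      by (simp add: integral_unique Y0 Y2 del: integral_divide)
    also have "(\<lambda>t. lev' (R * cos t) / (4 * sqrt pi) * (\<phi> (Y t) * (1 + exp (\<phi> (Y t)))))
        = (\<lambda>t. (\<lambda>c. (2 * (R * c) - (R * c)\<^sup>2 * lev' (R * c) + lev (R * c) * (R * c)) / (2 * sqrt pi)) (cos t))"
    proof
      fix t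
      define u where "u = R * cos t"
      have eq: "\<phi> (Y t) = lev u" by (simp add: \<phi>_def sY u_def)
      \<comment> \<open>Removing \<open>lev u * lev' u\<close> leaves only terms whose integrals are
        combinations of 0, \<open>act R\<close> and \<open>per R\<close>.\<close>
      have e: "lev u * lev' u = 2 * u - u\<^sup>2 * lev' u"
        using lev'_times[of u] by (simp add: algebra_simps)
      have "lev' u * (lev u * (1 + exp (lev u))) = 2 * (lev u * lev' u) + lev u * ((u\<^sup>2 + lev u) * lev' u)"
        by (simp add: exp_lev algebra_simps)
      also have "\<dots> = 2 * (2 * u - u\<^sup>2 * lev' u) + lev u * (2 * u)"
        by (simp only: e lev'_times)
      finally have k: "lev' u * (lev u * (1 + exp (lev u))) = 2 * (2 * u - u\<^sup>2 * lev' u) + lev u * (2 * u)" .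
      have "lev' u * (lev u * (1 + exp (lev u))) / (4 * sqrt pi)
          = (2 * u - u\<^sup>2 * lev' u + lev u * u) / (2 * sqrt pi)"
        unfolding k by (simp add: field_simps)
      then show "lev' (R * cos t) / (4 * sqrt pi) * (\<phi> (Y t) * (1 + exp (\<phi> (Y t))))
        = (\<lambda>c. (2 * (R * c) - (R * c)\<^sup>2 * lev' (R * c) + lev (R * c) * (R * c)) / (2 * sqrt pi)) (cos t)"
        unfolding eq u_def[symmetric] by simp
    qed
    also have "integral {0..2 * pi} \<dots> = 2 * integral {0..pi} (\<lambda>t. (2 * (R * cos t) - (R * cos t)\<^sup>2 * lev' (R * cos t)
        + lev (R * cos t) * (R * cos t)) / (2 * sqrt pi))"
      by (rule integral_cos_reflect) (intro continuous_intros, auto)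
    also have "integral {0..pi} (\<lambda>t. (2 * (R * cos t) - (R * cos t)\<^sup>2 * lev' (R * cos t)
        + lev (R * cos t) * (R * cos t)) / (2 * sqrt pi)) = (2 * act R - R\<^sup>2 * per R) / (2 * sqrt pi)"
    proof -
      have "((\<lambda>t. 2 * R * cos t) has_integral 2 * R * sin pi - 2 * R * sin 0) {0..pi}"
        by (rule fundamental_theorem_of_calculus)
           (auto intro!: derivative_eq_intros simp flip: has_real_derivative_iff_has_vector_derivative)
      then have 1: "((\<lambda>t. 2 * R * cos t) has_integral 0) {0..pi}" by simp
      have 2: "((\<lambda>s. lev (R * cos s) * (R * cos s)) has_integral act R) {0..pi}"
        unfolding act_def by (intro integrable_integral integrable_continuous_interval continuous_intros)
      have 3: "((\<lambda>s. lev' (R * cos s)) has_integral per R) {0..pi}"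
        unfolding per_def by (intro integrable_integral integrable_continuous_interval continuous_intros)
      \<comment> \<open>Writing \<open>- (R * cos t)\<^sup>2\<close> as
        \<open>(R * sin t)\<^sup>2 - R\<^sup>2\<close> splits the term with \<open>lev'\<close> into
        a second copy of the action and a multiple of \<open>per R\<close>.\<close>
      have "((\<lambda>t. (2 * R * cos t + lev' (R * cos t) * (R * sin t)\<^sup>2 + lev (R * cos t) * (R * cos t)
          - R\<^sup>2 * lev' (R * cos t)) / (2 * sqrt pi)) has_integral (0 + act R + act R - R\<^sup>2 * per R) / (2 * sqrt pi)) {0..pi}"
        by (intro has_integral_divide has_integral_diff has_integral_add has_integral_mult_right 1 2 3 act_by_parts)
      moreover have "2 * R * cos t + lev' (R * cos t) * (R * sin t)\<^sup>2 + lev (R * cos t) * (R * cos t)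
          - R\<^sup>2 * lev' (R * cos t) = 2 * (R * cos t) - (R * cos t)\<^sup>2 * lev' (R * cos t)
          + lev (R * cos t) * (R * cos t)" for t
        by (simp add: power_mult_distrib sin_squared_eq algebra_simps)
      ultimately show ?thesis by (simp add: integral_unique del: integral_divide)
    qed
    finally show ?thesis by (simp add: field_simps)
  qed
  then have "1 / (2 * b) * integral {0..b} (\<lambda>y. \<phi> y * (1 + exp (\<phi> y))) = act R / (sqrt pi * b) - R\<^sup>2"
    using b by (simp add: per field_simps)
  moreover have "smooth_real \<phi>" using \<phi> \<psi> by (rule smooth_real_ode)
  moreover have "\<phi> (y + b) = \<phi> y" for y by (simp add: \<phi>_def shift)
  moreover have "\<phi> y \<le> \<phi> 0" for y using R by (simp add: \<phi>_def s0)
  moreover have "deriv (deriv \<phi>) y = 8 * pi * (1 - exp (\<phi> y))" for y by (simp only: d1 d2)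
  ultimately show ?thesis using that[of \<phi>] by blast
qed

section \<open>Upper bound for the action\<close>

text \<open>The action is the area \<open>\<integral> sqrt (R\<^sup>2 - pot \<phi>) d\<phi>\<close> between the turning points. Along a curve
  \<open>\<psi>\<close> joining the turning points the integrand is estimated by Young's inequality.\<close>

lemma act_le_curve:
  assumes R: "R \<ge> 0" and \<beta>: "\<beta> > 0" and B: "B \<ge> 0"
    and ends: "\<psi> 0 = lev R" "\<psi> B = lev (- R)"
    and range: "\<And>t. t \<in> {0..B} \<Longrightarrow> \<psi> t \<in> {lev (- R)..lev R}"
    and \<psi>: "\<And>t. t \<in> {0..B} \<Longrightarrow> (\<psi> has_real_derivative \<psi>' t) (at t)"
    and W: "\<And>t. t \<in> {0..B} \<Longrightarrow> (W has_real_derivative w t) (at t)"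
    and le: "\<And>t. t \<in> {0..B} \<Longrightarrow> (R\<^sup>2 - pot (\<psi> t)) / \<beta> + \<beta> / 4 * (\<psi>' t)\<^sup>2 \<le> w t"
  shows "act R \<le> W B - W 0"
proof -
  \<comment> \<open>The cutoff makes \<open>\<sigma>\<close> continuous on the whole line, which
    provides a global antiderivative; between the turning points it is inactive.\<close>
  define \<sigma> where "\<sigma> x = sqrt (max 0 (R\<^sup>2 - pot x))" for x
  have "continuous_on UNIV \<sigma>" unfolding \<sigma>_def pot_def by (intro continuous_intros)
  then obtain S where S: "\<And>x. (S has_real_derivative \<sigma> x) (at x)"
    using continuous_real_antiderivative by blast
  have "((\<lambda>s. - (lev' (R * cos s) * (R * sin s)\<^sup>2)) has_integral S (lev (R * cos pi)) - S (lev (R * cos 0))) {0..pi}"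
  proof (rule fundamental_theorem_of_calculus)
    fix s assume s: "s \<in> {0..pi}"
    have "\<sigma> (lev (R * cos s)) = sqrt (max 0 ((R * sin s)\<^sup>2))"
      by (simp add: \<sigma>_def power_mult_distrib sin_squared_eq algebra_simps flip: amp_sq)
    also have "\<dots> = R * sin s" using R s by (simp add: sin_ge_zero)
    finally have "\<sigma> (lev (R * cos s)) = R * sin s" .
    moreover have "((\<lambda>s. S (lev (R * cos s))) has_real_derivative
        \<sigma> (lev (R * cos s)) * (lev' (R * cos s) * (R * - sin s))) (at s within {0..pi})"
      by (rule DERIV_chain2[OF S]) (auto intro!: derivative_eq_intros)
    ultimately show "((\<lambda>s. S (lev (R * cos s))) has_vector_derivative
        - (lev' (R * cos s) * (R * sin s)\<^sup>2)) (at s within {0..pi})"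
      by (simp add: power2_eq_square mult_ac flip: has_real_derivative_iff_has_vector_derivative)
  qed simp
  from has_integral_unique[OF this has_integral_neg[OF act_by_parts]]
  have act: "act R = S (\<psi> 0) - S (\<psi> B)" by (simp add: ends)
  \<comment> \<open>The sum of \<open>W t\<close> and \<open>S (\<psi> t)\<close> is nondecreasing:
    its derivative is at least a perfect square, which is Young's inequality pointwise.\<close>
  have "W 0 + S (\<psi> 0) \<le> W B + S (\<psi> B)"
  proof (rule DERIV_nonneg_imp_nondecreasing[OF B])
    fix t assume "0 \<le> t" "t \<le> B"
    then have t: "t \<in> {0..B}" by simp
    have "((\<lambda>t. W t + S (\<psi> t)) has_real_derivative w t + \<sigma> (\<psi> t) * \<psi>' t) (at t)"
      by (intro DERIV_add W t DERIV_chain2[OF S] \<psi>)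
    moreover have "w t + \<sigma> (\<psi> t) * \<psi>' t \<ge> 0"
    proof -
      have "amp (lev (- R)) \<le> amp (\<psi> t)" "amp (\<psi> t) \<le> amp (lev R)"
        using range[OF t] by (simp_all only: strict_mono_less_eq[OF strict_mono_amp] atLeastAtMost_iff)
      then have "(amp (\<psi> t))\<^sup>2 \<le> R\<^sup>2" using R by (intro abs_le_square_iff[THEN iffD1]) auto
      then have "(\<sigma> (\<psi> t))\<^sup>2 = R\<^sup>2 - pot (\<psi> t)" by (simp add: \<sigma>_def amp_sq)
      then have "(R\<^sup>2 - pot (\<psi> t)) / \<beta> + \<beta> / 4 * (\<psi>' t)\<^sup>2 + \<sigma> (\<psi> t) * \<psi>' t
          = (2 * \<sigma> (\<psi> t) + \<beta> * \<psi>' t)\<^sup>2 / (4 * \<beta>)"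
        using \<beta> by (simp add: field_simps power2_eq_square)
      also have "\<dots> \<ge> 0" using \<beta> by simp
      finally show ?thesis using le[OF t] by simp
    qed
    ultimately show "\<exists>y. ((\<lambda>t. W t + S (\<psi> t)) has_real_derivative y) (at t) \<and> y \<ge> 0" by blast
  qed
  then show ?thesis by (simp add: act)
qed

section \<open>The explicit test curve\<close>

lemma DERIV_tanh: "(tanh has_real_derivative 1 - (tanh t)\<^sup>2) (at t)" for t :: real
  by (auto intro!: derivative_eq_intros)

text \<open>A concave function lies above its chord. This gives the sign of the slope of the test
  curve, which keeps the curve between the turning points.\<close>

lemma tanh_secant:
  fixes t B :: real
  assumes "0 \<le> t" "t \<le> B" "B > 0"
  shows "tanh B * t / B \<le> tanh t"
proof -
  have "concave_on {0..} (tanh :: real \<Rightarrow> real)"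
  proof (rule f''_le0_imp_concave)
    show "(tanh has_real_derivative 1 - (tanh x)\<^sup>2) (at x)" for x :: real
      by (rule DERIV_tanh)
    show "((\<lambda>x. 1 - (tanh x)\<^sup>2) has_real_derivative - 2 * tanh x * (1 - (tanh x)\<^sup>2)) (at x)" for x :: real
      by (auto intro!: derivative_eq_intros)
    show "- 2 * tanh x * (1 - (tanh x)\<^sup>2) \<le> 0" if "x \<in> {0..}" for x :: real
      using that tanh_real_bounds[of x] by (simp add: mult_le_0_iff abs_square_le_1)
  qed auto
  from concave_onD[OF this, of "t / B" 0 B] assms show ?thesis by (simp add: mult_ac)
qed

lemma DERIV_ln_cosh: "((\<lambda>t. ln (cosh t)) has_real_derivative tanh t) (at t)" for t :: real
  by (auto intro!: derivative_eq_intros simp: tanh_def)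

text \<open>The test curve is \<open>C - 2 ln cosh t + T t\<^sup>2 / B\<close>: the Liouville bubble plus the parabola of the
  neutralizing background. The factor \<open>T = tanh B\<close> makes the slope vanish at \<open>t = B\<close>, and \<open>C\<close> puts both
  ends on the same energy level.\<close>

lemma act_le_test:
  fixes B :: real
  defines "T \<equiv> tanh B"
  defines "D \<equiv> 2 * ln (cosh B) - T * B"
  defines "C \<equiv> ln (D / (1 - exp (- D)))"
  assumes B: "B > 0" and D: "D > 0"
  obtains R where "R > 0"
    "act R / sqrt B \<le> R\<^sup>2 + 1 + C + B + (T + T\<^sup>2) * B / 3 - exp C * T / B - T - 2 * T * ln (cosh B)"
proof -
  have T: "0 < T" "T < 1" using B by (auto simp: T_def tanh_real_lt_1)
  have eD: "1 - exp (- D) > 0" using D by simp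
  have pD: "1 - exp (- D) < D" using pot_pos[of "- D"] D by (simp add: pot_def)
  have expC: "exp C = D / (1 - exp (- D))" unfolding C_def using D eD by (intro exp_ln) simp
  have "exp C > 1" using eD pD by (simp add: expC)
  then have C: "C > 0" by simp
  \<comment> \<open>\<open>D\<close> is the drop of the curve from \<open>t = 0\<close> to
    \<open>t = B\<close>. Equality of \<open>pot\<close> at \<open>C\<close> and
    \<open>C - D\<close> means \<open>exp C * (1 - exp (- D)) = D\<close>, whence the formula for
    \<open>C\<close>.\<close>
  have low: "exp (C - D) = exp C - D"
  proof -
    have "exp C * (1 - exp (- D)) = D" using eD by (simp add: expC)
    then show ?thesis by (simp add: algebra_simps flip: exp_add)
  qed
  \<comment> \<open>Together with \<open>C > 0\<close> this puts the ends on opposite sides of the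
    well, so that \<open>amp\<close> takes the values \<open>R\<close> and \<open>- R\<close>
    there.\<close>
  have "C < D"
  proof -
    have "exp D > 1 + D" using pot_pos[of D] D by (simp add: pot_def)
    then have "D < exp D * (1 - exp (- D))" by (simp add: algebra_simps flip: exp_add)
    then have "exp C < exp D" using eD by (simp add: expC field_simps)
    then show ?thesis by simp
  qed
  define R where "R = amp C"
  have R: "R > 0" using C pot_pos[of C] by (simp add: R_def amp_def)
  have levR: "lev R = C" by (simp add: R_def)
  have "amp (C - D) = - R"
    using C \<open>C < D\<close> low by (simp add: R_def amp_def pot_def)
  then have lev_R: "lev (- R) = C - D" by (metis lev_amp)
  define \<psi> where "\<psi> t = C - 2 * ln (cosh t) + T * t\<^sup>2 / B" for t
  define \<psi>' where "\<psi>' t = - 2 * tanh t + 2 * (T * t / B)" for t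
  have \<psi>: "(\<psi> has_real_derivative \<psi>' t) (at t)" for t
    unfolding \<psi>_def \<psi>'_def using B
    by (auto intro!: derivative_eq_intros simp: tanh_def mult_ac)
  have \<psi>'_le: "\<psi>' t \<le> 0" if "t \<in> {0..B}" for t
    using tanh_secant[of t B] that B by (simp add: \<psi>'_def T_def)
  have \<psi>_mono: "\<psi> v \<le> \<psi> u" if "0 \<le> u" "u \<le> v" "v \<le> B" for u v
    by (rule DERIV_nonpos_imp_nonincreasing[OF \<open>u \<le> v\<close>]) (use \<psi> \<psi>'_le that in force)
  have \<psi>_ends: "\<psi> 0 = C" "\<psi> B = C - D"
    using B by (simp_all add: \<psi>_def D_def power2_eq_square)
  \<comment> \<open>Two losses make the bound integrable in closed form: the parabola is dropped
    inside \<open>exp (\<psi> t)\<close>, leaving a multiple of \<open>1 - (tanh t)\<^sup>2\<close>,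
    and \<open>- 2 * ln (cosh t)\<close> is weakened to \<open>- 2 * T * ln (cosh t)\<close>, which
    pairs with the cross term of the squared slope into the derivative of
    \<open>- 2 * T * (t * ln (cosh t))\<close>.\<close>
  define W where "W t = ((R\<^sup>2 + 1 + C + B) * t + (T + T\<^sup>2) / B * (t ^ 3 / 3) - (exp C + B) * tanh t
      - 2 * T * (t * ln (cosh t))) / sqrt B" for t
  define w where "w t = ((R\<^sup>2 + 1 + C + B) + (T + T\<^sup>2) / B * t\<^sup>2 - (exp C + B) * (1 - (tanh t)\<^sup>2)
      - 2 * T * (ln (cosh t) + t * tanh t)) / sqrt B" for t
  have "act R \<le> W B - W 0"
  proof (rule act_le_curve[where \<psi> = \<psi> and \<psi>' = \<psi>' and w = w and \<beta> = "sqrt B"])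
    show "\<psi> t \<in> {lev (- R)..lev R}" if "t \<in> {0..B}" for t
      using \<psi>_mono[of 0 t] \<psi>_mono[of t B] that by (simp add: levR lev_R \<psi>_ends)
    show "(W has_real_derivative w t) (at t)" for t
    proof -
      have cube: "((\<lambda>t. t ^ 3 / 3) has_real_derivative t\<^sup>2) (at t)" by (auto intro!: derivative_eq_intros)
      have "(W has_real_derivative ((R\<^sup>2 + 1 + C + B) * 1 + (T + T\<^sup>2) / B * t\<^sup>2 - (exp C + B) * (1 - (tanh t)\<^sup>2)
          - 2 * T * (1 * ln (cosh t) + tanh t * t)) / sqrt B) (at t)"
        unfolding W_def
        by (intro DERIV_cdivide DERIV_diff DERIV_add DERIV_cmult DERIV_mult DERIV_ident DERIV_ln_cosh DERIV_tanh cube)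
      then show ?thesis by (simp add: w_def mult_ac)
    qed
    show "(R\<^sup>2 - pot (\<psi> t)) / sqrt B + sqrt B / 4 * (\<psi>' t)\<^sup>2 \<le> w t" if t: "t \<in> {0..B}" for t
    proof -
      define l where "l = ln (cosh t)"
      define \<tau> where "\<tau> = tanh t"
      have l: "l \<ge> 0" using cosh_real_ge_1[of t] by (simp add: l_def)
      have "exp C * (1 - \<tau>\<^sup>2) = exp (C - 2 * l)"
      proof -
        have "exp (2 * l) = (cosh t)\<^sup>2"
          by (simp add: l_def exp_double)
        moreover have "1 - \<tau>\<^sup>2 = 1 / (cosh t)\<^sup>2"
        proof -
          have nz: "(cosh t)\<^sup>2 \<noteq> 0" by simp
          have "((cosh t)\<^sup>2 - (sinh t)\<^sup>2) / (cosh t)\<^sup>2 = 1 / (cosh t)\<^sup>2"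
            by (simp only: hyperbolic_pythagoras)
          then show ?thesis
            by (simp only: \<tau>_def tanh_def power_divide diff_divide_distrib divide_self[OF nz])
        qed
        ultimately show ?thesis by (simp add: exp_diff)
      qed
      also have "\<dots> \<le> exp (\<psi> t)" using T B t by (simp add: \<psi>_def l_def)
      finally have 1: "exp C * (1 - \<tau>\<^sup>2) \<le> exp (\<psi> t)" .
      have 2: "0 \<le> 2 * l * (1 - T)" using l T by simp
      have 3: "B / 4 * (\<psi>' t)\<^sup>2 = B * \<tau>\<^sup>2 - 2 * T * t * \<tau> + T\<^sup>2 / B * t\<^sup>2"
        using B by (simp add: \<psi>'_def \<tau>_def field_simps power2_eq_square)
      have 4: "R\<^sup>2 - pot (\<psi> t) = R\<^sup>2 + 1 + C - 2 * l + T / B * t\<^sup>2 - exp (\<psi> t)"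
        unfolding pot_def by (subst (2) \<psi>_def) (simp add: l_def)
      have "R\<^sup>2 - pot (\<psi> t) + B / 4 * (\<psi>' t)\<^sup>2 \<le>
          (R\<^sup>2 + 1 + C + B) + (T + T\<^sup>2) / B * t\<^sup>2 - (exp C + B) * (1 - \<tau>\<^sup>2) - 2 * T * (l + t * \<tau>)"
        unfolding 3 4 using 1 2 by (simp add: algebra_simps add_divide_distrib)
      then have "(R\<^sup>2 - pot (\<psi> t) + B / 4 * (\<psi>' t)\<^sup>2) / sqrt B \<le> w t"
        unfolding w_def \<tau>_def l_def using B by (intro divide_right_mono) auto
      moreover have "B / 4 * (\<psi>' t)\<^sup>2 / sqrt B = sqrt B / 4 * (\<psi>' t)\<^sup>2"
      proof -
        have "B / 4 * (\<psi>' t)\<^sup>2 / sqrt B = (B / sqrt B) / 4 * (\<psi>' t)\<^sup>2" by simp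
        then show ?thesis using B by (simp only: real_div_sqrt less_imp_le)
      qed
      ultimately show ?thesis by (simp only: add_divide_distrib)
    qed
  qed (use R B \<psi> in \<open>auto simp: \<psi>_ends levR lev_R\<close>)
  then have "act R / sqrt B \<le> (W B - W 0) / sqrt B" using B by (intro divide_right_mono) auto
  also have "\<dots> = ((R\<^sup>2 + 1 + C + B) * B + (T + T\<^sup>2) / B * (B ^ 3 / 3) - (exp C + B) * T
      - 2 * T * (B * ln (cosh B))) / B"
    using B by (simp add: W_def T_def)
  also have "\<dots> = R\<^sup>2 + 1 + C + B + (T + T\<^sup>2) * B / 3 - exp C * T / B - T - 2 * T * ln (cosh B)"
    using B by (simp add: field_simps power3_eq_cube)
  finally show ?thesis using R that by blast
qed

section \<open>Numerical estimates\<close>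

text \<open>Termwise \<open>- ln (1 - x) \<le> x / (1 - x)\<close>, summed geometrically;
  \<open>q \<le> 1 / 4\<close> makes \<open>(1 - q)\<^sup>2 \<ge> 1 / 2\<close>.\<close>

lemma suminf_ln_one_minus_power_ge:
  fixes q :: real
  assumes q: "0 < q" "q \<le> 1 / 4"
  shows "- (\<Sum>n. ln \<bar>1 - q ^ Suc n\<bar>) \<le> 2 * q"
proof -
  have le1: "q ^ Suc n \<le> q" "q ^ Suc n > 0" for n
    using q power_le_one[of q n] by (simp_all add: mult_left_le)
  have bound: "0 \<le> - ln \<bar>1 - q ^ Suc n\<bar> \<and> - ln \<bar>1 - q ^ Suc n\<bar> \<le> q / (1 - q) * q ^ n" for n
  proof -
    define x where "x = q ^ Suc n"
    have x: "0 < x" "x \<le> q" unfolding x_def by (rule le1)+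
    then have x1: "x < 1" using q by simp
    note x = x x1
    have "- ln (1 - x) = ln (1 / (1 - x))" using x by (simp add: ln_div)
    also have "\<dots> \<le> 1 / (1 - x) - 1" using x by (intro ln_le_minus_one) simp
    also have "\<dots> = x / (1 - x)" using x by (simp add: field_simps)
    also have "\<dots> \<le> x / (1 - q)" using x q by (intro divide_left_mono) auto
    finally show ?thesis using x by (simp add: x_def)
  qed
  have geo: "(\<lambda>n. q / (1 - q) * q ^ n) sums (q / (1 - q) * (1 / (1 - q)))"
    using q by (intro sums_mult geometric_sums) simp
  have sm: "summable (\<lambda>n. - ln \<bar>1 - q ^ Suc n\<bar>)"
    by (rule summable_comparison_test'[OF sums_summable[OF geo], of 0]) (use bound in \<open>simp del: power_Suc\<close>)
  have "- (\<Sum>n. ln \<bar>1 - q ^ Suc n\<bar>) = (\<Sum>n. - ln \<bar>1 - q ^ Suc n\<bar>)"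
    using suminf_minus[OF summable_minus[OF sm]] by (simp del: power_Suc)
  also have "\<dots> \<le> (\<Sum>n. q / (1 - q) * q ^ n)"
    by (rule suminf_le[OF _ sm sums_summable[OF geo]]) (use bound in blast)
  also have "\<dots> = q / (1 - q) * (1 / (1 - q))" using geo by (rule sums_unique[symmetric])
  also have "\<dots> \<le> 2 * q"
  proof -
    have "(3 / 4)\<^sup>2 \<le> (1 - q)\<^sup>2" using q by (intro power_mono) auto
    then have "1 \<le> 2 * (1 - q)\<^sup>2" by (simp add: power2_eq_square)
    then have "q * 1 \<le> q * (2 * (1 - q)\<^sup>2)" using q by (intro mult_left_mono) auto
    then have "q / (1 - q)\<^sup>2 \<le> 2 * q" using q by (subst pos_divide_le_eq) (auto simp: mult_ac)
    then show ?thesis by (simp add: power2_eq_square)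
  qed
  finally show ?thesis .
qed

text \<open>Tailored to make the exponentially small errors less than
  \<open>1 / (3 * B\<^sup>2)\<close>. Of the six factors \<open>exp (B / 3)\<close>, four supply a
  numerical constant and two the cubic in \<open>B\<close>.\<close>

lemma exp_double_ge:
  fixes B :: real
  assumes "B \<ge> 9 / 2"
  shows "3 * B\<^sup>2 * (4 * B + 12) < exp (2 * B)"
proof -
  define u where "u = B / 3"
  define p where "p = 1 + u + u\<^sup>2 / 2"
  have u: "u \<ge> 3 / 2" using assms by (simp add: u_def)
  have "(3 / 2)\<^sup>2 \<le> u\<^sup>2" using u by (intro power_mono) auto
  then have p: "p \<ge> 29 / 8" using u by (simp add: p_def power2_eq_square)
  \<comment> \<open>A difference of squares:
    \<open>p\<^sup>2 - (1 + u - u\<^sup>2 / 2)\<^sup>2\<close> equals the left side exactly.\<close>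
  have p2: "2 * (u\<^sup>2 * (1 + u)) \<le> p\<^sup>2"
    using zero_le_power2[of "1 + u - u\<^sup>2 / 2"] by (simp add: p_def power2_eq_square algebra_simps)
  have "(29 / 8) ^ 4 \<le> p ^ 4" using p by (intro power_mono) auto
  then have p4: "172 \<le> p ^ 4" by (simp add: power4_eq_xxxx)
  have pos: "u\<^sup>2 * (1 + u) > 0" using u by (intro mult_pos_pos) auto
  have "3 * B\<^sup>2 * (4 * B + 12) = 324 * (u\<^sup>2 * (1 + u))"
    by (simp add: u_def power2_eq_square algebra_simps)
  also have "\<dots> < 172 * (2 * (u\<^sup>2 * (1 + u)))" using pos by linarith
  also have "\<dots> \<le> p ^ 4 * p\<^sup>2" using p4 p2 pos by (intro mult_mono) auto
  also have "\<dots> = p ^ 6" by (simp flip: power_add)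
  also have "\<dots> \<le> exp u ^ 6"
    using exp_lower_Taylor_quadratic[of u] u p by (intro power_mono) (auto simp: p_def)
  also have "\<dots> = exp (2 * B)" by (simp add: u_def flip: exp_of_nat_mult)
  finally show ?thesis .
qed

lemma ln_one_minus_le:
  fixes z :: real
  assumes "0 \<le> z" "z < 1"
  shows "ln (1 - z) \<le> - z - z\<^sup>2 / 2"
proof -
  have "ln (1 - z) + z + z\<^sup>2 / 2 \<le> ln (1 - 0) + 0 + 0\<^sup>2 / 2"
  proof (rule DERIV_nonpos_imp_nonincreasing[OF assms(1)])
    fix x assume x: "0 \<le> x" "x \<le> z"
    then have "((\<lambda>x. ln (1 - x) + x + x\<^sup>2 / 2) has_real_derivative - 1 / (1 - x) + 1 + x) (at x)"
      using assms by (auto intro!: derivative_eq_intros)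
    moreover have "- 1 / (1 - x) + 1 + x = - x\<^sup>2 / (1 - x)"
      using x assms by (simp add: field_simps power2_eq_square)
    moreover have "- x\<^sup>2 / (1 - x) \<le> 0" using x assms by simp
    ultimately show "\<exists>y. ((\<lambda>x. ln (1 - x) + x + x\<^sup>2 / 2) has_real_derivative y) (at x) \<and> y \<le> 0" by metis
  qed
  then show ?thesis by simp
qed

text \<open>With \<open>r = exp C / B\<close> the main terms cancel down to
  \<open>ln r + 1 - r\<close>. The errors add up to \<open>q * (4 * B + 12)\<close>:
  \<open>4 * q * B\<close> from replacing \<open>T\<close> by 1 before \<open>ln (cosh B)\<close>,
  \<open>2 * q\<close> each from \<open>1 - T\<close> and \<open>r * (1 - T)\<close>, and
  \<open>8 * q\<close> from the series.\<close>

lemma test_value_negative: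
  fixes B :: real
  defines "T \<equiv> tanh B"
  defines "D \<equiv> 2 * ln (cosh B) - T * B"
  defines "C \<equiv> ln (D / (1 - exp (- D)))"
  assumes B: "B > 9 / 2"
  shows "D > 0"
    "1 + C + B + (T + T\<^sup>2) * B / 3 - exp C * T / B - T - 2 * T * ln (cosh B)
      + B / 3 - ln (4 * B) + 1 - 4 * (\<Sum>n. ln \<bar>1 - exp (- 2 * real (Suc n) * B)\<bar>) < 0"
proof -
  define q where "q = exp (- (2 * B))"
  define L where "L = ln (cosh B)"
  have q: "q > 0" by (simp add: q_def)
  have q_small: "q * (4 * B + 12) < 1 / (3 * B\<^sup>2)"
  proof -
    have "q * (3 * B\<^sup>2 * (4 * B + 12)) < q * exp (2 * B)"
      using exp_double_ge[of B] B q by (intro mult_strict_left_mono) auto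
    also have "q * exp (2 * B) = 1" by (simp add: q_def flip: exp_add)
    finally show ?thesis using B by (subst pos_less_divide_eq) (auto simp: mult_ac)
  qed
  have "1 / (3 * B\<^sup>2) \<le> 1 / 60"
  proof -
    have "(9 / 2)\<^sup>2 \<le> B\<^sup>2" using B by (intro power_mono) auto
    then show ?thesis by (simp add: field_simps power2_eq_square)
  qed
  with q_small have q60: "q * (4 * B + 12) < 1 / 60" by simp
  moreover have "q * 30 \<le> q * (4 * B + 12)" using q B by (intro mult_left_mono) auto
  ultimately have q4: "q \<le> 1 / 4" by simp
  have T: "1 - T = 2 * q / (1 + q)"
  proof -
    have "exp (- 2 * B) = q" by (simp add: q_def)
    then have "T = (1 - q) / (1 + q)" by (simp only: T_def tanh_real_altdef)
    then show ?thesis using q by (simp add: field_simps)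
  qed
  have T_le: "1 - T \<le> 2 * q" and T1: "T < 1"
    using q tanh_real_lt_1[of B] by (simp_all add: T T_def[symmetric] pos_divide_le_eq)
  have T0: "T > 0" using B by (simp add: T_def)
  have L: "L = B - ln 2 + ln (1 + q)"
  proof -
    have "cosh B = exp B / 2 * (1 + q)"
      by (simp add: cosh_def q_def algebra_simps flip: exp_add)
    then have "L = ln (exp B / 2 * (1 + q))" by (simp only: L_def)
    also have "\<dots> = ln (exp B / 2) + ln (1 + q)" using q by (subst ln_mult) auto
    finally show ?thesis by (simp add: ln_div)
  qed
  have lnq: "0 \<le> ln (1 + q)" "ln (1 + q) \<le> q" using q ln_add_one_self_le_self[of q] by auto
  have ln2: "2 / 3 \<le> ln (2::real)" "ln (2::real) < 7 / 10"
    using ln2_ge_two_thirds ln2_le_25_over_36 by simp_all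
  have L_le: "L \<le> B" using L lnq ln2 q4 by linarith
  have L0: "L \<ge> 0" using L lnq ln2 B by linarith
  have D_eq: "D = B - 2 * ln 2 + 2 * ln (1 + q) + (1 - T) * B"
    by (simp add: D_def L[unfolded L_def] algebra_simps)
  have TB: "0 \<le> (1 - T) * B" "(1 - T) * B \<le> 2 * q * B"
    using T1 T_le B by (auto intro!: mult_right_mono)
  have D_ge: "D \<ge> B - 7 / 5" using D_eq TB lnq ln2 by linarith
  then show D: "D > 0" using B by simp
  have D_le: "D \<le> B - 33 / 25"
  proof -
    have "2 * q + 2 * q * B = q * (4 * B + 12) / 2 - 4 * q" by (simp add: algebra_simps)
    with q60 have "2 * q + 2 * q * B \<le> 1 / 120" using q by linarith
    then show ?thesis using D_eq TB lnq ln2 by linarith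
  qed
  define r where "r = exp C / B"
  have eD: "1 - exp (- D) > 0" using D by simp
  have expC: "exp C = D / (1 - exp (- D))" unfolding C_def using D eD by (intro exp_ln) simp
  \<comment> \<open>\<open>D\<close> is about \<open>B - 2 * ln 2\<close> and
    \<open>2 * ln 2 > 1\<close>, which leaves room for \<open>exp C \<le> B - 1\<close>. The target
    \<open>8 / 25\<close> is the slack \<open>33 / 25 - 1\<close> in the upper bound on
    \<open>D\<close>.\<close>
  have "D \<le> (B - 1) * (1 - exp (- D))"
  proof -
    define x where "x = B - 7 / 5"
    have x: "x \<ge> 31 / 10" using B by (simp add: x_def)
    define p where "p = 1 + x / 2 + (x / 2)\<^sup>2 / 2"
    have p_eq: "p = 1 + x / 2 + x * x / 8" by (simp add: p_def power2_eq_square)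
    have "31 / 10 * x \<le> x * x" using x by (intro mult_right_mono) auto
    then have p1: "1 + 71 / 80 * x \<le> p" unfolding p_eq by linarith
    then have p2: "15 / 4 \<le> p" using x by linarith
    have "15 / 4 * (1 + 71 / 80 * x) \<le> p * p" using x p1 p2 by (intro mult_mono) auto
    also have "\<dots> = p\<^sup>2" by (simp add: power2_eq_square)
    also have "\<dots> \<le> exp (x / 2) ^ 2"
      unfolding p_def using x by (intro power_mono exp_lower_Taylor_quadratic) auto
    also have "\<dots> = exp x" by (simp flip: exp_of_nat_mult)
    finally have "15 / 4 * (1 + 71 / 80 * x) \<le> exp x" .
    then have "x + 2 / 5 \<le> 8 / 25 * exp x" using x by simp
    then have "(x + 2 / 5) * exp (- x) \<le> 8 / 25" by (simp add: exp_minus field_simps)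
    moreover have "exp (- D) \<le> exp (- x)" using D_ge by (simp add: x_def)
    then have "(x + 2 / 5) * exp (- D) \<le> (x + 2 / 5) * exp (- x)" using x by (intro mult_left_mono) auto
    ultimately have "(B - 1) * exp (- D) \<le> 8 / 25" by (simp add: x_def)
    then show ?thesis using D_le by (simp add: algebra_simps)
  qed
  then have "exp C \<le> B - 1" using eD by (simp add: expC field_simps)
  then have r_le: "r \<le> 1 - 1 / B" using B by (simp add: r_def field_simps)
  have r0: "r > 0" using B by (simp add: r_def)
  have lnr: "ln r = C - ln B" using B by (simp add: r_def ln_div)
  \<comment> \<open>The left side is \<open>ln r + 1 - r\<close>, negative to second order in
    \<open>z = 1 - r\<close>, and \<open>z \<ge> 1 / B\<close>.\<close>
  have "C - ln B + 1 - r \<le> - 1 / (2 * B\<^sup>2)"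
  proof -
    define z where "z = 1 - r"
    have z: "1 / B \<le> z" "z < 1" using r_le r0 by (auto simp: z_def)
    then have "ln (1 - z) \<le> - z - z\<^sup>2 / 2" using B by (intro ln_one_minus_le) (auto intro: order_trans[rotated])
    then have "C - ln B + 1 - r \<le> - z\<^sup>2 / 2" using lnr by (simp add: z_def)
    also have "(1 / B)\<^sup>2 \<le> z\<^sup>2" using z B by (intro power_mono) auto
    then have "- z\<^sup>2 / 2 \<le> - 1 / (2 * B\<^sup>2)" by (simp add: power_divide)
    finally show ?thesis .
  qed
  moreover have "r * (1 - T) \<le> 2 * q"
  proof -
    have "r \<le> 1" using order_trans[OF r_le, of 1] B by simp
    then show ?thesis using mult_mono[of r 1 "1 - T" "2 * q"] T_le T1 by simp
  qed
  moreover have "2 * ((1 - T) * L) \<le> 4 * q * B"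
    using mult_mono[of "1 - T" "2 * q" L B] T_le L_le L0 q T1 by linarith
  moreover have "(T + T\<^sup>2) * B / 3 \<le> 2 * B / 3"
    using T0 T1 B abs_square_le_1[of T] by (intro divide_right_mono mult_right_mono) auto
  moreover have "- (\<Sum>n. ln \<bar>1 - exp (- 2 * real (Suc n) * B)\<bar>) \<le> 2 * q"
  proof -
    have "exp (- 2 * real (Suc n) * B) = q ^ Suc n" for n
      unfolding q_def exp_of_nat_mult[symmetric] by (simp add: algebra_simps)
    with suminf_ln_one_minus_power_ge[OF q q4] show ?thesis by simp
  qed
  moreover have "ln (4 * B) = 2 * ln 2 + ln B"
    using B ln_realpow[of 2 2] by (simp add: ln_mult)
  moreover have "- 1 / (2 * B\<^sup>2) + q * (4 * B + 12) < 0"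
  proof -
    have "1 / (3 * B\<^sup>2) < 1 / (2 * B\<^sup>2)" using B by (simp add: field_simps)
    then show ?thesis using q_small by simp
  qed
  moreover have "q * (4 * B + 12) = 4 * q * B + 12 * q" by (simp add: algebra_simps)
  moreover have "exp C * T / B = r - r * (1 - T)"
  proof -
    have "exp C * T / B = r * T" by (simp add: r_def)
    then show ?thesis by (simp add: algebra_simps)
  qed
  moreover have "2 * T * ln (cosh B) = 2 * L - 2 * ((1 - T) * L)" by (simp add: L_def algebra_simps)
  ultimately show "1 + C + B + (T + T\<^sup>2) * B / 3 - exp C * T / B - T - 2 * T * ln (cosh B)
      + B / 3 - ln (4 * B) + 1 - 4 * (\<Sum>n. ln \<bar>1 - exp (- 2 * real (Suc n) * B)\<bar>) < 0"
    using T_le L lnq q by linarith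
qed

theorem mainTheorem4:
  fixes b :: real
  assumes "b > sqrt (pi / 2)"
  shows "\<exists>\<phi> :: real \<Rightarrow> real.
           smooth_real \<phi> \<and>
           (\<forall>y. deriv (deriv \<phi>) y = 8 * pi * (1 - exp (\<phi> y))) \<and>
           (\<forall>y. \<phi> (y + b) = \<phi> y) \<and>
           (\<forall>y. \<phi> y \<le> \<phi> 0) \<and>
           (let \<beta> = sqrt pi * b in
              1 / (2 * b) * integral {0..b} (\<lambda>y. \<phi> y * (1 + exp (\<phi> y)))
              + \<beta>\<^sup>2 / 3 - ln (4 * \<beta>\<^sup>2) + 1
              - 4 * (\<Sum>n. ln \<bar>1 - exp (- 2 * real (Suc n) * \<beta>\<^sup>2)\<bar>) < 0)"
proof -
  define B where "B = pi * b\<^sup>2"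
  have "sqrt (pi / 2) > 0" using pi_gt_zero by simp
  with assms have b: "b > 0" by linarith
  \<comment> \<open>The threshold \<open>sqrt (pi / 2)\<close> is the period of the linearized
    equation \<open>phi'' = - 8 pi phi\<close>; it gives \<open>B > pi\<^sup>2 / 2\<close>, and
    \<open>pi > 3\<close>.\<close>
  have B: "B > 9 / 2"
  proof -
    have "sqrt (pi / 2) ^ 2 < b\<^sup>2" using assms by (intro power_strict_mono) auto
    then have "pi / 2 < b\<^sup>2" by simp
    then have "pi * (pi / 2) < B" unfolding B_def by (intro mult_strict_left_mono) auto
    moreover have "3 * 3 \<le> pi * pi" using pi_gt3 by (intro mult_mono) auto
    ultimately show ?thesis by linarith
  qed
  then have B0: "B > 0" by simp
  have sqrtB: "sqrt pi * b = sqrt B" using b by (simp add: B_def real_sqrt_mult)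
  define S where "S = (\<Sum>n. ln \<bar>1 - exp (- 2 * real (Suc n) * B)\<bar>)"
  define V where "V = B / 3 - ln (4 * B) + 1 - 4 * S"
  obtain R where R: "R > 0" "act R / sqrt B - R\<^sup>2 + V < 0"
  proof -
    note neg = test_value_negative[OF B, folded S_def]
    obtain R where "R > 0" "act R / sqrt B \<le> R\<^sup>2
        + (1 + ln ((2 * ln (cosh B) - tanh B * B) / (1 - exp (- (2 * ln (cosh B) - tanh B * B)))) + B
          + (tanh B + (tanh B)\<^sup>2) * B / 3
          - exp (ln ((2 * ln (cosh B) - tanh B * B) / (1 - exp (- (2 * ln (cosh B) - tanh B * B))))) * tanh B / B
          - tanh B - 2 * tanh B * ln (cosh B))"
      by (rule act_le_test[OF B0 neg(1)]) (simp only: add.assoc add_diff_eq)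
    with neg(2) that[of R] show ?thesis unfolding V_def by linarith
  qed
  obtain R0 where R0: "R0 \<ge> 0" "\<And>r. r \<ge> 0 \<Longrightarrow> act R0 / sqrt B - R0\<^sup>2 \<le> act r / sqrt B - r\<^sup>2"
    "R0 = 0 \<or> per R0 = 2 * sqrt B"
    using act_minimizer[of "sqrt B"] B0 by auto
  have neg: "act R0 / sqrt B - R0\<^sup>2 + V < 0" using R0(2)[of R] R by linarith
  obtain \<phi> where \<phi>: "smooth_real \<phi>"
    "\<And>y. deriv (deriv \<phi>) y = 8 * pi * (1 - exp (\<phi> y))"
    "\<And>y. \<phi> (y + b) = \<phi> y" "\<And>y. \<phi> y \<le> \<phi> 0"
    "1 / (2 * b) * integral {0..b} (\<lambda>y. \<phi> y * (1 + exp (\<phi> y))) = act R0 / sqrt B - R0\<^sup>2"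
  proof (cases "R0 = 0")
    \<comment> \<open>At zero energy the orbit is the rest point: the zero function is
      \<open>b\<close>-periodic and has the value \<open>act 0 / sqrt B - 0 = 0\<close>.\<close>
    case True
    have "smooth_real (\<lambda>y. 0)" by (rule smooth_real_ode[where q = "\<lambda>y. 0" and c = 0]) auto
    with True that[of "\<lambda>y. 0"] show ?thesis by simp
  next
    case False
    with R0 have "R0 > 0" by simp
    moreover have "per R0 = 2 * sqrt pi * b" using R0(3) False by (simp flip: sqrtB)
    ultimately show ?thesis using orbit_solution[OF _ b] that unfolding sqrtB by blast
  qed
  have "1 / (2 * b) * integral {0..b} (\<lambda>y. \<phi> y * (1 + exp (\<phi> y))) + B / 3 - ln (4 * B) + 1 - 4 * S < 0"
    using neg unfolding \<phi>(5) V_def by linarith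
  moreover have "(sqrt pi * b)\<^sup>2 = B" by (simp add: B_def power_mult_distrib)
  ultimately have "let \<beta> = sqrt pi * b in
              1 / (2 * b) * integral {0..b} (\<lambda>y. \<phi> y * (1 + exp (\<phi> y)))
              + \<beta>\<^sup>2 / 3 - ln (4 * \<beta>\<^sup>2) + 1
              - 4 * (\<Sum>n. ln \<bar>1 - exp (- 2 * real (Suc n) * \<beta>\<^sup>2)\<bar>) < 0"
    by (simp only: Let_def S_def)
  with \<phi> show ?thesis by blast
qed

end
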